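(* Let $\mathcal{A} = (P, X, d, \lessapprox, \vartriangleleft)$ be an approximate asymptotic space, $(\mathcal{K},\oplus)$ a system of precompact sets for $\mathcal{A}$, $p\in P$, $\mathcal{X}\subseteq X^\omega$, and $\Delta$ a sequence of positive real numbers. Suppose that player I has a strategy in $F_p$ to reach $\mathcal{X}$. Then player I has a strategy in $SF_p$ to build a sequence $(K_n)_{n\in\omega}$ such that $\mathrm{bs}((K_n)_{n\in\omega})\subseteq(\mathcal{X})_\Delta$.
   Context: An \emph{approximate asymptotic space} is a quintuple $\mathcal{A} = (P, X, d, \lessapprox, \vartriangleleft)$, where $P$ is a nonempty set, $(X,d)$ is a nonempty separable metric space, $\lessapprox$ is a quasiorder on $P$, and $\vartriangleleft\ \subseteq X\times P$, such that: (1) for all $p,q,r\in P$, if $q\lessapprox p$ and $r\lessapprox p$, then there is $u\in P$ with $u\lessapprox q$ and $u\lessapprox r$; (2) for every $p\in P$ there is $x\in X$ with $x\vartriangleleft p$; (3) for every $x\in X$ and $p,q\in P$, if $x\vartriangleleft p$ and $p\lessapprox q$ then $x\vartriangleleft q$. For $\mathcal{X}\subseteq X^\omega$ and $\Delta=(\Delta_n)_{n\in\omega}$ a sequence of positive reals, $(\mathcal{X})_\Delta = \{(x_n)\in X^\omega \mid \exists (y_n)\in\mathcal{X}\ \forall n\ d(x_n,y_n)\leqslant\Delta_n\}$. A subset of $X$ is \emph{precompact} if its closure in $X$ is compact. For $K\subseteq X$ and $p\in P$, write $K\vartriangleleft p$ if $\{x\in K\mid x\vartriangleleft p\}$ is dense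 in $K$. A \emph{system of precompact sets} for $\mathcal{A}$ is a set $\mathcal{K}$ of precompact subsets of $X$ with an associative binary operation $\oplus$ on $\mathcal{K}$ such that for every $p\in P$ and $K,L\in\mathcal{K}$, if $K\vartriangleleft p$ and $L\vartriangleleft p$ then $K\oplus L\vartriangleleft p$. For a sequence $(K_n)_{n\in\omega}$ in $\mathcal{K}$ and a nonempty finite $A\subseteq\omega$ with elements $n_1<\cdots<n_k$, $\bigoplus_{n\in A}K_n = K_{n_1}\oplus\cdots\oplus K_{n_k}$. A \emph{block sequence} of $(K_n)$ is a sequence $(x_i)_{i\in\omega}\in X^\omega$ for which there are nonempty sets of integers $A_0<A_1<A_2<\cdots$ (where $A<B$ means that every element of $A$ is smaller than every element of $B$) with $x_i\in\bigoplus_{n\in A_i}K_n$ for all $i$. $\mathrm{bs}((K_n)_{n\in\omega})$ is the set of all block sequences of $(K_n)$. The \emph{asymptotic game} $F_p$: I plays $p_0$, II plays $x_0$, I plays $p_1$, II plays $x_1$, etc., with $p_i\in P$, $x_i\in X$; rule for I: $p_i\lessapprox p$ for all $i$; rule for II: $x_i\vartriangleleft p_i$ for all $i$; the outcome is $(x_i)_{i\in\omega}\in X^\omega$. The \emph{strong asymptotic game} $SF_p$: I plays $p_0$, II plays $K_0$, I plays $p_1$, II plays $K_1$, etc., with $p_n\in P$, $K_n\in\mathcal{K}$; rule for I: $p_n\lessapprox p$ for all $n$; rule for II: $K_n\vartriangleleft p_n$ for all $n$; the outcome is $(K_n)_{n\in\omega}\in\mathcal{K}^\omega$. A player \emph{has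 a strategy to reach} a set in a game (or to build an outcome with a given property) if she/he has a winning strategy in the game with those rules and whose winning condition for that player is that the outcome belongs to the set (has the property). *)

theory Defs
  imports "HOL-Analysis.Analysis"
begin

locale approximate_asymptotic_space = Metric_space X d
  for P :: "'p set" and X :: "'x set" and d :: "'x \<Rightarrow> 'x \<Rightarrow> real" +
  fixes le :: "'p \<Rightarrow> 'p \<Rightarrow> bool" (infix "\<lesssim>" 50)
    and tri :: "'x \<Rightarrow> 'p \<Rightarrow> bool" (infix "\<lhd>" 50)
  assumes P_nonempty: "P \<noteq> {}"
    and X_nonempty: "X \<noteq> {}"
    and separable: "\<exists>C. countable C \<and> C \<subseteq> X \<and> mtopology closure_of C = X"
    and le_refl: "reflp_on P (\<lesssim>)"
    and le_trans: "transp_on P (\<lesssim>)"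
    and tri_carrier: "x \<lhd> p \<Longrightarrow> x \<in> X \<and> p \<in> P"
    and amalgamation: "\<lbrakk>p \<in> P; q \<in> P; r \<in> P; q \<lesssim> p; r \<lesssim> p\<rbrakk>
      \<Longrightarrow> \<exists>u\<in>P. u \<lesssim> q \<and> u \<lesssim> r"
    and tri_exists: "p \<in> P \<Longrightarrow> \<exists>x\<in>X. x \<lhd> p"
    and tri_mono: "\<lbrakk>x \<in> X; p \<in> P; q \<in> P; x \<lhd> p; p \<lesssim> q\<rbrakk> \<Longrightarrow> x \<lhd> q"

definition expansion ::
  "'x set \<Rightarrow> ('x \<Rightarrow> 'x \<Rightarrow> real) \<Rightarrow> (nat \<Rightarrow> real) \<Rightarrow> (nat \<Rightarrow> 'x) set \<Rightarrow> (nat \<Rightarrow> 'x) set"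
  where "expansion X d \<Delta> \<X> =
    {x \<in> UNIV \<rightarrow> X. \<exists>y\<in>\<X>. \<forall>n. d (x n) (y n) \<le> \<Delta> n}"

definition precompact :: "'x set \<Rightarrow> ('x \<Rightarrow> 'x \<Rightarrow> real) \<Rightarrow> 'x set \<Rightarrow> bool"
  where "precompact X d K \<longleftrightarrow> K \<subseteq> X \<and>
    compactin (Metric_space.mtopology X d) (Metric_space.mtopology X d closure_of K)"

text \<open>\<open>K \<lhd> p\<close> for a set \<open>K\<close>: the points \<open>x \<in> K\<close> with \<open>x \<lhd> p\<close> are dense in \<open>K\<close>.\<close>

definition set_tri ::
  "'x set \<Rightarrow> ('x \<Rightarrow> 'x \<Rightarrow> real) \<Rightarrow> ('x \<Rightarrow> 'p \<Rightarrow> bool) \<Rightarrow> 'x set \<Rightarrow> 'p \<Rightarrow> bool"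
  where "set_tri X d tri K p \<longleftrightarrow>
    K \<subseteq> Metric_space.mtopology X d closure_of {x \<in> K. tri x p}"

locale system_of_precompact_sets = approximate_asymptotic_space P X d le tri
  for P :: "'p set" and X :: "'x set" and d :: "'x \<Rightarrow> 'x \<Rightarrow> real"
    and le :: "'p \<Rightarrow> 'p \<Rightarrow> bool" and tri :: "'x \<Rightarrow> 'p \<Rightarrow> bool" +
  fixes \<K> :: "'x set set"
    and oplus :: "'x set \<Rightarrow> 'x set \<Rightarrow> 'x set" (infixl "\<oplus>\<^sub>K" 65)
  assumes K_precompact: "K \<in> \<K> \<Longrightarrow> precompact X d K"
    and oplus_closed: "\<lbrakk>K \<in> \<K>; L \<in> \<K>\<rbrakk> \<Longrightarrow> K \<oplus>\<^sub>K L \<in> \<K>"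
    and oplus_assoc: "\<lbrakk>K \<in> \<K>; L \<in> \<K>; M \<in> \<K>\<rbrakk>
      \<Longrightarrow> (K \<oplus>\<^sub>K L) \<oplus>\<^sub>K M = K \<oplus>\<^sub>K (L \<oplus>\<^sub>K M)"
    and oplus_tri: "\<lbrakk>p \<in> P; K \<in> \<K>; L \<in> \<K>; set_tri X d tri K p; set_tri X d tri L p\<rbrakk>
      \<Longrightarrow> set_tri X d tri (K \<oplus>\<^sub>K L) p"

text \<open>Meaningful only for finite nonempty \<open>A\<close>; the summands are taken in increasing order
  of their indices.\<close>

definition big_oplus ::
  "('x set \<Rightarrow> 'x set \<Rightarrow> 'x set) \<Rightarrow> (nat \<Rightarrow> 'x set) \<Rightarrow> nat set \<Rightarrow> 'x set"
  where "big_oplus oplus K A =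
    (let Ks = map K (sorted_list_of_set A) in foldl oplus (hd Ks) (tl Ks))"

definition block_sequences ::
  "'x set \<Rightarrow> ('x set \<Rightarrow> 'x set \<Rightarrow> 'x set) \<Rightarrow> (nat \<Rightarrow> 'x set) \<Rightarrow> (nat \<Rightarrow> 'x) set"
  where "block_sequences X oplus K = {x \<in> UNIV \<rightarrow> X. \<exists>A :: nat \<Rightarrow> nat set.
    (\<forall>i. finite (A i) \<and> A i \<noteq> {}) \<and>
    (\<forall>i. \<forall>a\<in>A i. \<forall>b\<in>A (Suc i). a < b) \<and>
    (\<forall>i. x i \<in> big_oplus oplus K (A i))}"

text \<open>
  Infinite games in which player I plays \<open>a\<^sub>0\<close>, II plays \<open>b\<^sub>0\<close>, I plays \<open>a\<^sub>1\<close>, and so on, the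
  outcome being \<open>(b\<^sub>n)\<close>. Player I may play \<open>a\<close> iff \<open>ruleI a\<close>, and player II may answer
  \<open>a\<close> by \<open>b\<close> iff \<open>ruleII a b\<close>. A strategy for I gives her next move as a function of the
  list of the previous moves of II. A player who breaks the rules first loses; in particular
  II loses if he has no legal move. So a winning strategy for I must give a legal move after
  every finite legal sequence of answers of II, and the outcome of every infinite run in
  which it is followed and II obeys his rule must lie in the target set.
\<close>

definition legal_answers :: "('a \<Rightarrow> 'b \<Rightarrow> bool) \<Rightarrow> ('b list \<Rightarrow> 'a) \<Rightarrow> 'b list \<Rightarrow> bool"
  where "legal_answers ruleII \<sigma> bs \<longleftrightarrow>
    (\<forall>n<length bs. ruleII (\<sigma> (take n bs)) (bs ! n))"

definition winning_strategy_I ::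
  "('a \<Rightarrow> bool) \<Rightarrow> ('a \<Rightarrow> 'b \<Rightarrow> bool) \<Rightarrow> (nat \<Rightarrow> 'b) set \<Rightarrow> ('b list \<Rightarrow> 'a) \<Rightarrow> bool"
  where "winning_strategy_I ruleI ruleII W \<sigma> \<longleftrightarrow>
    (\<forall>bs. legal_answers ruleII \<sigma> bs \<longrightarrow> ruleI (\<sigma> bs)) \<and>
    (\<forall>b. (\<forall>n. legal_answers ruleII \<sigma> (map b [0..<n])) \<longrightarrow> b \<in> W)"

definition I_has_strategy_F ::
  "'p set \<Rightarrow> 'x set \<Rightarrow> ('p \<Rightarrow> 'p \<Rightarrow> bool) \<Rightarrow> ('x \<Rightarrow> 'p \<Rightarrow> bool)
    \<Rightarrow> 'p \<Rightarrow> (nat \<Rightarrow> 'x) set \<Rightarrow> bool"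
  where "I_has_strategy_F P X le tri p W \<longleftrightarrow>
    (\<exists>\<sigma>. winning_strategy_I
      (\<lambda>q. q \<in> P \<and> le q p)
      (\<lambda>q x. x \<in> X \<and> tri x q) W \<sigma>)"

definition I_has_strategy_SF ::
  "'p set \<Rightarrow> 'x set \<Rightarrow> ('x \<Rightarrow> 'x \<Rightarrow> real) \<Rightarrow> ('p \<Rightarrow> 'p \<Rightarrow> bool) \<Rightarrow> ('x \<Rightarrow> 'p \<Rightarrow> bool)
    \<Rightarrow> 'x set set \<Rightarrow> 'p \<Rightarrow> (nat \<Rightarrow> 'x set) set \<Rightarrow> bool"
  where "I_has_strategy_SF P X d le tri \<K> p W \<longleftrightarrow>
    (\<exists>\<sigma>. winning_strategy_I
      (\<lambda>q. q \<in> P \<and> le q p)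
      (\<lambda>q K. K \<in> \<K> \<and> set_tri X d tri K q) W \<sigma>)"

end

theory Submission
  imports Defs
begin

text \<open>
  Player I wins the strong game by simulating, at the same time, finitely many runs of \<open>F\<^sub>p\<close>
  played with her given strategy \<open>\<sigma>\<close>. Suppose that a position \<open>z = (y\<^sub>0, \<dots>, y\<^sub>k\<^sub>-\<^sub>1)\<close> of \<open>F\<^sub>p\<close>
  is being simulated and that from some time \<open>m\<close> on all moves \<open>p\<^sub>n\<close> of I in the strong game
  satisfy \<open>p\<^sub>n \<lesssim> \<sigma> z\<close>. Then every \<open>K\<^sub>n\<close> with \<open>n \<ge> m\<close> satisfies \<open>K\<^sub>n \<lhd> \<sigma> z\<close>, hence so does
  \<open>L = \<Oplus>\<^sub>n\<^sub>\<in>\<^sub>A K\<^sub>n\<close> for each block \<open>A\<close> lying beyond \<open>m\<close>. As \<open>L\<close> is precompact and the points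
  \<open>y \<lhd> \<sigma> z\<close> are dense in it, finitely many of them form a \<open>\<Delta>\<^sub>k\<close>-net of \<open>L\<close>
  (\<open>precompact_dense_finite_net\<close>). The points of this net are legal answers of II to
  \<open>\<sigma> z\<close>, and the positions extended by them are simulated next.

  After finitely many moves of the strong game there are only finitely many blocks, so only
  finitely many simulated positions (\<open>finite_net_tree\<close>), and by amalgamation I can play
  below the values of \<open>\<sigma>\<close> at all of them (\<open>finite_amalgamation\<close>). A block sequence
  \<open>(x\<^sub>i)\<close> is then approximated one term at a time: \<open>x\<^sub>i\<close> is within \<open>\<Delta>\<^sub>i\<close> of some \<open>y\<^sub>i\<close> in the
  net belonging to \<open>(y\<^sub>0, \<dots>, y\<^sub>i\<^sub>-\<^sub>1)\<close> and the \<open>i\<close>th block (\<open>net_tree_extend\<close>), so \<open>(y\<^sub>i)\<close> is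
  a run of \<open>F\<^sub>p\<close> against \<open>\<sigma>\<close> and lies in \<open>\<X>\<close>.
\<close>

lemma legal_answers_snoc:
  "legal_answers R \<sigma> (z @ [y]) \<longleftrightarrow> legal_answers R \<sigma> z \<and> R (\<sigma> z) y"
  by (auto simp: legal_answers_def less_Suc_eq nth_append)

lemma big_oplus_cong:
  assumes "finite A" "\<And>n. n \<in> A \<Longrightarrow> K n = K' n"
  shows "big_oplus f K A = big_oplus f K' A"
proof -
  have "map K (sorted_list_of_set A) = map K' (sorted_list_of_set A)"
    using assms by (auto intro: map_cong)
  then show ?thesis unfolding big_oplus_def by (rule arg_cong)
qed

text \<open>A property closed under the operation passes from the summands to the sum. Applied to
  ``belongs to the system and is related to \<open>q\<close>'', it makes the sum along a block a set that
  has a net of legal answers to \<open>q\<close>.\<close>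

lemma big_oplus_closed:
  assumes fin: "finite A" and ne: "A \<noteq> {}" and K: "\<And>n. n \<in> A \<Longrightarrow> C (K n)"
    and closed: "\<And>L M. C L \<Longrightarrow> C M \<Longrightarrow> C (f L M)"
  shows "C (big_oplus f K A)"
proof -
  have foldl: "C (foldl f L Ls)" if "C L" "\<forall>M\<in>set Ls. C M" for L Ls
    using that by (induction Ls arbitrary: L) (auto intro: closed)
  obtain n ns where ns: "sorted_list_of_set A = n # ns"
    using fin ne by (cases "sorted_list_of_set A") auto
  have "set (n # ns) = A" using ns fin by (metis set_sorted_list_of_set)
  then show ?thesis
    using K by (auto simp: big_oplus_def ns intro!: foldl)
qed

context Metric_space
begin

text \<open>The balls of radius \<open>\<epsilon>\<close> around the points of a dense subset cover not only the set but
  its compact closure, so finitely many of them suffice; precompactness alone would give a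
  net whose points need not lie in the dense subset.\<close>

lemma precompact_dense_finite_net:
  assumes pre: "precompact M d L" and dense: "L \<subseteq> mtopology closure_of D"
    and D: "D \<subseteq> L" and \<epsilon>: "\<epsilon> > 0"
  obtains F where "finite F" "F \<subseteq> D" "\<And>x. x \<in> L \<Longrightarrow> \<exists>y\<in>F. d x y \<le> \<epsilon>"
proof -
  let ?C = "mtopology closure_of L"
  have LM: "L \<subseteq> M" and cpt: "compactin mtopology ?C"
    using pre by (auto simp: precompact_def)
  have "?C \<subseteq> mtopology closure_of D"
    using dense by (simp add: closure_of_minimal)
  moreover have "mtopology closure_of D \<subseteq> \<Union> ((\<lambda>y. mball y \<epsilon>) ` D)"
    using \<epsilon> commute by (fastforce simp: metric_closure_of)
  ultimately have "?C \<subseteq> \<Union> ((\<lambda>y. mball y \<epsilon>) ` D)" by blast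
  then obtain \<F> where \<F>: "finite \<F>" "\<F> \<subseteq> (\<lambda>y. mball y \<epsilon>) ` D" "?C \<subseteq> \<Union>\<F>"
    using compactinD[OF cpt, of "(\<lambda>y. mball y \<epsilon>) ` D"] by auto
  then obtain F where F: "finite F" "F \<subseteq> D" "\<F> = (\<lambda>y. mball y \<epsilon>) ` F"
    by (meson finite_subset_image)
  have "\<exists>y\<in>F. d x y \<le> \<epsilon>" if "x \<in> L" for x
  proof -
    have "x \<in> ?C" using that LM closure_of_subset[of L mtopology] by auto
    then obtain y where "y \<in> F" "x \<in> mball y \<epsilon>" using \<F>(3) F(3) by auto
    then show ?thesis by (metis commute in_mball less_imp_le)
  qed
  with F show thesis using that by blast
qed

end

context approximate_asymptotic_space
begin

lemma finite_amalgamation: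
  assumes p: "p \<in> P" and "finite Q" "\<And>q. q \<in> Q \<Longrightarrow> q \<in> P \<and> le q p"
  shows "\<exists>u\<in>P. le u p \<and> (\<forall>q\<in>Q. le u q)"
  using assms(2,3)
proof (induction Q rule: finite_induct)
  case empty
  then show ?case using p le_refl by (auto simp: reflp_on_def)
next
  case (insert q Q)
  then obtain u where u: "u \<in> P" "le u p" "\<forall>r\<in>Q. le u r" by auto
  obtain v where v: "v \<in> P" "le v u" "le v q"
    using amalgamation[OF p u(1) _ u(2)] insert.prems by blast
  have trans: "le v r" if "r \<in> P" "le u r" for r
    using le_trans v u that by (meson transp_onD)
  show ?case
    using trans v u p insert.prems by (intro bexI[of _ v]) auto
qed

lemma set_tri_mono:
  assumes "set_tri X d tri K q" "q \<in> P" "r \<in> P" "le q r"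
  shows "set_tri X d tri K r"
proof -
  have "{x \<in> K. tri x q} \<subseteq> {x \<in> K. tri x r}"
    using assms tri_mono tri_carrier by blast
  then show ?thesis
    using assms(1) closure_of_mono unfolding set_tri_def by blast
qed

text \<open>A choice of nets made once and for all. The covering property is demanded only where it
  can be met; elsewhere any finite set of admissible points will do, so that finiteness and
  admissibility hold for all arguments.\<close>

definition net :: "'x set \<Rightarrow> 'p \<Rightarrow> real \<Rightarrow> 'x set" where
  "net L q \<epsilon> = (SOME F. finite F \<and> F \<subseteq> {x \<in> L. tri x q} \<and>
     (precompact X d L \<and> set_tri X d tri L q \<and> \<epsilon> > 0 \<longrightarrow> (\<forall>x\<in>L. \<exists>y\<in>F. d x y \<le> \<epsilon>)))"

lemma net:
  shows finite_net: "finite (net L q \<epsilon>)"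
    and net_tri: "y \<in> net L q \<epsilon> \<Longrightarrow> tri y q"
    and net_covers: "\<lbrakk>precompact X d L; set_tri X d tri L q; \<epsilon> > 0; x \<in> L\<rbrakk>
      \<Longrightarrow> \<exists>y\<in>net L q \<epsilon>. d x y \<le> \<epsilon>"
proof -
  let ?Q = "\<lambda>F. finite F \<and> F \<subseteq> {x \<in> L. tri x q} \<and>
     (precompact X d L \<and> set_tri X d tri L q \<and> \<epsilon> > 0 \<longrightarrow> (\<forall>x\<in>L. \<exists>y\<in>F. d x y \<le> \<epsilon>))"
  have "\<exists>F. ?Q F"
  proof (cases "precompact X d L \<and> set_tri X d tri L q \<and> \<epsilon> > 0")
    case True
    then obtain F where "finite F" "F \<subseteq> {x \<in> L. tri x q}"
        "\<And>x. x \<in> L \<Longrightarrow> \<exists>y\<in>F. d x y \<le> \<epsilon>"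
      using precompact_dense_finite_net[of L "{x \<in> L. tri x q}" \<epsilon>]
      by (auto simp: set_tri_def)
    then show ?thesis by blast
  next
    case False
    then show ?thesis by (intro exI[of _ "{}"]) auto
  qed
  then have Q: "?Q (net L q \<epsilon>)"
    unfolding net_def by (rule someI_ex)
  show "finite (net L q \<epsilon>)" using Q by blast
  show "y \<in> net L q \<epsilon> \<Longrightarrow> tri y q" using Q by blast
  show "\<lbrakk>precompact X d L; set_tri X d tri L q; \<epsilon> > 0; x \<in> L\<rbrakk>
      \<Longrightarrow> \<exists>y\<in>net L q \<epsilon>. d x y \<le> \<epsilon>" using Q by blast
qed

end

context system_of_precompact_sets
begin

text \<open>The simulated positions of \<open>F\<^sub>p\<close> with \<open>k\<close> moves of II whose blocks lie in \<open>{..<n}\<close>. The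
  bound \<open>m\<close> separates the last block from the earlier ones; it is a parameter of the
  recursion because it records from which time on the position before the last answer has
  constrained the moves of I.\<close>

primrec net_tree ::
  "('x list \<Rightarrow> 'p) \<Rightarrow> (nat \<Rightarrow> real) \<Rightarrow> (nat \<Rightarrow> 'x set) \<Rightarrow> nat \<Rightarrow> nat \<Rightarrow> 'x list set" where
  "net_tree \<sigma> \<Delta> K 0 n = {[]}"
| "net_tree \<sigma> \<Delta> K (Suc k) n =
    (\<Union>m\<in>{..<n}. \<Union>A\<in>{A. A \<subseteq> {m..<n} \<and> A \<noteq> {}}. \<Union>z\<in>net_tree \<sigma> \<Delta> K k m.
      (\<lambda>y. z @ [y]) ` net (big_oplus oplus K A) (\<sigma> z) (\<Delta> k))"

lemma net_tree_SucI:
  assumes "z \<in> net_tree \<sigma> \<Delta> K k m" "A \<subseteq> {m..<n}" "A \<noteq> {}"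
    "y \<in> net (big_oplus oplus K A) (\<sigma> z) (\<Delta> k)"
  shows "z @ [y] \<in> net_tree \<sigma> \<Delta> K (Suc k) n"
proof -
  have "m \<in> {..<n}" using assms(2,3) by force
  then show ?thesis using assms unfolding net_tree.simps by blast
qed

lemma finite_net_tree: "finite (net_tree \<sigma> \<Delta> K k n)"
proof (induction k arbitrary: n)
  case (Suc k)
  have "finite {A. A \<subseteq> {m..<n} \<and> A \<noteq> {}}" for m
    by (rule finite_subset[of _ "Pow {m..<n}"]) auto
  then show ?case using Suc by (simp add: finite_net)
qed simp

lemma net_tree_mono: "m \<le> n \<Longrightarrow> net_tree \<sigma> \<Delta> K k m \<subseteq> net_tree \<sigma> \<Delta> K k n"
proof (cases k)
  case (Suc l)
  assume "m \<le> n"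
  then have "{..<m} \<subseteq> {..<n}" and "{i..<m} \<subseteq> {i..<n}" for i by auto
  then have "{A. A \<subseteq> {i..<m} \<and> A \<noteq> {}} \<subseteq> {A. A \<subseteq> {i..<n} \<and> A \<noteq> {}}" for i by blast
  with \<open>{..<m} \<subseteq> {..<n}\<close> show ?thesis
    unfolding Suc net_tree.simps by (intro UN_mono subset_refl)
qed simp

lemma net_tree_cong:
  "(\<And>i. i < n \<Longrightarrow> K i = K' i) \<Longrightarrow> net_tree \<sigma> \<Delta> K k n = net_tree \<sigma> \<Delta> K' k n"
proof (induction k arbitrary: n)
  case (Suc k)
  have tree: "net_tree \<sigma> \<Delta> K k m = net_tree \<sigma> \<Delta> K' k m" if "m < n" for m
    using Suc that by simp
  have sum: "big_oplus oplus K A = big_oplus oplus K' A" if "A \<subseteq> {m..<n}" for m A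
    using that Suc.prems by (intro big_oplus_cong) (auto intro: finite_subset)
  show ?case
    unfolding net_tree.simps by (intro SUP_cong refl) (auto simp: tree sum)
qed simp

lemma net_tree_legal:
  "z \<in> net_tree \<sigma> \<Delta> K k n \<Longrightarrow> legal_answers (\<lambda>q x. x \<in> X \<and> tri x q) \<sigma> z"
proof (induction k arbitrary: z n)
  case 0
  then show ?case by (simp add: legal_answers_def)
next
  case (Suc k)
  then obtain m A w y where "z = w @ [y]" "w \<in> net_tree \<sigma> \<Delta> K k m"
      "y \<in> net (big_oplus oplus K A) (\<sigma> w) (\<Delta> k)"
    unfolding net_tree.simps by blast
  then show ?case
    using Suc.IH net_tri tri_carrier by (simp add: legal_answers_snoc) blast
qed

text \<open>At stage \<open>n\<close> only the positions with at most \<open>n\<close> moves matter, as \<open>{..<n}\<close> does not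
  contain more than \<open>n\<close> consecutive blocks.\<close>

definition simulating_strategy ::
  "('x list \<Rightarrow> 'p) \<Rightarrow> (nat \<Rightarrow> real) \<Rightarrow> 'p \<Rightarrow> 'x set list \<Rightarrow> 'p" where
  "simulating_strategy \<sigma> \<Delta> p Ks = (SOME u. u \<in> P \<and> le u p \<and>
     (\<forall>k\<le>length Ks. \<forall>z\<in>net_tree \<sigma> \<Delta> (nth Ks) k (length Ks). le u (\<sigma> z)))"

lemma simulating_strategy:
  assumes p: "p \<in> P"
    and \<sigma>: "\<And>z. legal_answers (\<lambda>q x. x \<in> X \<and> tri x q) \<sigma> z \<Longrightarrow> \<sigma> z \<in> P \<and> le (\<sigma> z) p"
  shows "simulating_strategy \<sigma> \<Delta> p Ks \<in> P" (is ?in_P)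
    and "le (simulating_strategy \<sigma> \<Delta> p Ks) p" (is ?below_p)
    and "\<lbrakk>k \<le> length Ks; z \<in> net_tree \<sigma> \<Delta> (nth Ks) k (length Ks)\<rbrakk>
      \<Longrightarrow> le (simulating_strategy \<sigma> \<Delta> p Ks) (\<sigma> z)"
proof -
  let ?Q = "\<lambda>u. u \<in> P \<and> le u p \<and>
     (\<forall>k\<le>length Ks. \<forall>z\<in>net_tree \<sigma> \<Delta> (nth Ks) k (length Ks). le u (\<sigma> z))"
  let ?T = "\<Union>k\<in>{..length Ks}. net_tree \<sigma> \<Delta> (nth Ks) k (length Ks)"
  have "\<exists>u\<in>P. le u p \<and> (\<forall>q\<in>\<sigma> ` ?T. le u q)"
  proof (rule finite_amalgamation[OF p])
    show "finite (\<sigma> ` ?T)" by (simp add: finite_net_tree)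
    show "\<And>q. q \<in> \<sigma> ` ?T \<Longrightarrow> q \<in> P \<and> le q p"
      using \<sigma> net_tree_legal by blast
  qed
  then have "\<exists>u. ?Q u" by auto
  then have Q: "?Q (simulating_strategy \<sigma> \<Delta> p Ks)"
    unfolding simulating_strategy_def by (rule someI_ex)
  show ?in_P ?below_p using Q by blast+
  show "\<lbrakk>k \<le> length Ks; z \<in> net_tree \<sigma> \<Delta> (nth Ks) k (length Ks)\<rbrakk>
      \<Longrightarrow> le (simulating_strategy \<sigma> \<Delta> p Ks) (\<sigma> z)" using Q by blast
qed

text \<open>One step of the approximation. Every index \<open>n\<close> of the block is at least \<open>m\<close>, so \<open>z\<close>
  was already simulated when I chose her \<open>n\<close>th move, whence \<open>K n\<close> is related to \<open>\<sigma> z\<close>.\<close>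

lemma net_tree_extend:
  assumes p: "p \<in> P"
    and \<sigma>: "\<And>z. legal_answers (\<lambda>q x. x \<in> X \<and> tri x q) \<sigma> z \<Longrightarrow> \<sigma> z \<in> P \<and> le (\<sigma> z) p"
    and \<Delta>: "\<Delta> k > 0"
    and K: "\<And>n. K n \<in> \<K>"
    and K_tri: "\<And>n. set_tri X d tri (K n) (simulating_strategy \<sigma> \<Delta> p (map K [0..<n]))"
    and z: "z \<in> net_tree \<sigma> \<Delta> K k m" and km: "k \<le> m"
    and A: "finite A" "A \<noteq> {}" "A \<subseteq> {m..}"
    and x: "x \<in> big_oplus oplus K A"
  obtains y where "d x y \<le> \<Delta> k" "y \<in> net (big_oplus oplus K A) (\<sigma> z) (\<Delta> k)"
proof -
  let ?C = "\<lambda>L. L \<in> \<K> \<and> set_tri X d tri L (\<sigma> z)"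
  have \<sigma>z: "\<sigma> z \<in> P" using \<sigma> net_tree_legal[OF z] by blast
  have "?C (K n)" if "n \<in> A" for n
  proof -
    have mn: "m \<le> n" using A(3) that by auto
    have "net_tree \<sigma> \<Delta> (nth (map K [0..<n])) k n = net_tree \<sigma> \<Delta> K k n"
      by (rule net_tree_cong) simp
    then have "z \<in> net_tree \<sigma> \<Delta> (nth (map K [0..<n])) k (length (map K [0..<n]))"
      using subsetD[OF net_tree_mono[OF mn] z] by simp
    then have "le (simulating_strategy \<sigma> \<Delta> p (map K [0..<n])) (\<sigma> z)"
      using simulating_strategy(3)[where k = k and Ks = "map K [0..<n]", OF p \<sigma>] km mn by simp
    then show ?thesis
      using set_tri_mono[OF K_tri simulating_strategy(1)[OF p \<sigma>] \<sigma>z] K by blast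
  qed
  then have "?C (big_oplus oplus K A)"
    using A(1,2) by (rule_tac big_oplus_closed) (auto intro: oplus_closed oplus_tri[OF \<sigma>z])
  then show thesis
    using net_covers[OF K_precompact _ \<Delta> x] that by blast
qed

lemma block_sequence_in_expansion:
  assumes p: "p \<in> P" and \<Delta>: "\<And>n. \<Delta> n > 0"
    and \<sigma>: "winning_strategy_I (\<lambda>q. q \<in> P \<and> le q p) (\<lambda>q x. x \<in> X \<and> tri x q) \<X> \<sigma>"
    and K: "\<And>n. K n \<in> \<K>"
    and K_tri: "\<And>n. set_tri X d tri (K n) (simulating_strategy \<sigma> \<Delta> p (map K [0..<n]))"
    and x: "x \<in> block_sequences X oplus K"
  shows "x \<in> expansion X d \<Delta> \<X>"
proof -
  from x obtain A where xX: "x \<in> UNIV \<rightarrow> X"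
    and A: "\<forall>i. finite (A i) \<and> A i \<noteq> {}"
      "\<forall>i. \<forall>a\<in>A i. \<forall>b\<in>A (Suc i). a < b"
      "\<forall>i. x i \<in> big_oplus oplus K (A i)"
    unfolding block_sequences_def by (elim CollectE conjE exE)
  have fin: "\<And>i. finite (A i)" and ne: "\<And>i. A i \<noteq> {}"
    and less: "\<And>i a b. a \<in> A i \<Longrightarrow> b \<in> A (Suc i) \<Longrightarrow> a < b"
    and xA: "\<And>i. x i \<in> big_oplus oplus K (A i)"
    using A by simp_all
  have \<sigma>_rule: "\<sigma> z \<in> P \<and> le (\<sigma> z) p"
    if "legal_answers (\<lambda>q x. x \<in> X \<and> tri x q) \<sigma> z" for z
    using \<sigma> that by (simp add: winning_strategy_I_def)
  let ?inv = "\<lambda>k z. \<exists>m\<ge>k. A k \<subseteq> {m..} \<and> z \<in> net_tree \<sigma> \<Delta> K k m"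
  let ?step = "\<lambda>k z z'. \<exists>y. z' = z @ [y] \<and> d (x k) y \<le> \<Delta> k"
  have "\<exists>f. \<forall>k. ?inv k (f k) \<and> ?step k (f k) (f (Suc k))"
  proof (rule dependent_nat_choice)
    show "\<exists>z. ?inv 0 z" by (intro exI[of _ "[]"] exI[of _ 0]) auto
  next
    fix k z assume "?inv k z"
    then obtain m where m: "k \<le> m" "A k \<subseteq> {m..}" and z: "z \<in> net_tree \<sigma> \<Delta> K k m" by blast
    obtain y where y: "d (x k) y \<le> \<Delta> k"
        "y \<in> net (big_oplus oplus K (A k)) (\<sigma> z) (\<Delta> k)"
      using net_tree_extend[where \<Delta> = \<Delta>, OF p \<sigma>_rule \<Delta> K K_tri z m(1) fin ne m(2) xA] by blast
    \<comment> \<open>The next block starts after the end of the \<open>k\<close>th one.\<close>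
    define n where "n = Suc (Max (A k))"
    have "A k \<subseteq> {m..<n}"
      using m(2) fin[of k] by (auto simp: n_def less_Suc_eq_le)
    then have "z @ [y] \<in> net_tree \<sigma> \<Delta> K (Suc k) n"
      by (rule net_tree_SucI[OF z _ ne y(2)])
    moreover have "Suc k \<le> n"
      using Max_in[OF fin[of k] ne] m by (auto simp: n_def)
    moreover have "A (Suc k) \<subseteq> {n..}"
      using less[OF Max_in[OF fin ne]] by (auto simp: n_def Suc_le_eq)
    ultimately show "\<exists>z'. ?inv (Suc k) z' \<and> ?step k z z'"
      using y(1) by blast
  qed
  then obtain f where f: "\<And>k. ?inv k (f k)" and f_step: "\<And>k. ?step k (f k) (f (Suc k))"
    by metis
  have f0: "f 0 = []" using f[of 0] by auto
  define y where "y k = last (f (Suc k))" for k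
  have f_Suc: "f (Suc k) = f k @ [y k]" and dxy: "d (x k) (y k) \<le> \<Delta> k" for k
    using f_step[of k] by (auto simp: y_def)
  have "f k = map y [0..<k]" for k
    by (induction k) (simp_all add: f0 f_Suc)
  then have "legal_answers (\<lambda>q x. x \<in> X \<and> tri x q) \<sigma> (map y [0..<k])" for k
    using f[of k] net_tree_legal by metis
  then have "y \<in> \<X>" using \<sigma> by (simp add: winning_strategy_I_def)
  then show ?thesis using xX dxy by (auto simp: expansion_def)
qed

end

theorem theorem5p4:
  fixes P :: "'p set" and X :: "'x set" and d :: "'x \<Rightarrow> 'x \<Rightarrow> real"
    and le :: "'p \<Rightarrow> 'p \<Rightarrow> bool" and tri :: "'x \<Rightarrow> 'p \<Rightarrow> bool"
    and \<K> :: "'x set set" and oplus :: "'x set \<Rightarrow> 'x set \<Rightarrow> 'x set"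
    and p :: 'p and \<X> :: "(nat \<Rightarrow> 'x) set" and \<Delta> :: "nat \<Rightarrow> real"
  assumes "approximate_asymptotic_space P X d le tri"
    and "system_of_precompact_sets P X d le tri \<K> oplus"
    and "p \<in> P"
    and "\<X> \<subseteq> UNIV \<rightarrow> X"
    and "\<And>n. \<Delta> n > 0"
    and "I_has_strategy_F P X le tri p \<X>"
  shows "I_has_strategy_SF P X d le tri \<K> p
    {K. block_sequences X oplus K \<subseteq> expansion X d \<Delta> \<X>}"
proof -
  interpret system_of_precompact_sets P X d le tri \<K> oplus by fact
  obtain \<sigma> where \<sigma>: "winning_strategy_I (\<lambda>q. q \<in> P \<and> le q p) (\<lambda>q x. x \<in> X \<and> tri x q) \<X> \<sigma>"
    using assms(6) by (auto simp: I_has_strategy_F_def)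
  then have \<sigma>_rule: "\<sigma> z \<in> P \<and> le (\<sigma> z) p"
    if "legal_answers (\<lambda>q x. x \<in> X \<and> tri x q) \<sigma> z" for z
    using that by (simp add: winning_strategy_I_def)
  let ?\<tau> = "simulating_strategy \<sigma> \<Delta> p"
  let ?R = "\<lambda>q K. K \<in> \<K> \<and> set_tri X d tri K q"
  have "block_sequences X oplus K \<subseteq> expansion X d \<Delta> \<X>"
    if legal: "\<And>n. legal_answers ?R ?\<tau> (map K [0..<n])" for K
  proof -
    have "?R (?\<tau> (map K [0..<n])) (K n)" for n
      using legal[of "Suc n"] by (simp add: legal_answers_snoc)
    then have "K n \<in> \<K>" "set_tri X d tri (K n) (?\<tau> (map K [0..<n]))" for n
      by simp_all
    then show ?thesis
      by (intro subsetI)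
        (rule block_sequence_in_expansion[where \<Delta> = \<Delta>, OF \<open>p \<in> P\<close> assms(5) \<sigma>])
  qed
  then have "winning_strategy_I (\<lambda>q. q \<in> P \<and> le q p) ?R
      {K. block_sequences X oplus K \<subseteq> expansion X d \<Delta> \<X>} ?\<tau>"
    using simulating_strategy(1,2)[OF \<open>p \<in> P\<close> \<sigma>_rule]
    by (simp add: winning_strategy_I_def)
  then show ?thesis by (auto simp: I_has_strategy_SF_def)
qed

end
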